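(* For a topological space $X$, let $\mathrm{CW}(X)$ denote the CW-complex obtained by applying the functorial factorization described in the context to the map $\emptyset \to X$. If $X$ is a space, $S$ is a set, and for every element $s$ of $S$ we have a subspace $X_{s}$ of $X$, then each $\mathrm{CW}(X_{s})$ is a subcomplex of $\mathrm{CW}(X)$, and $$\bigcap_{s\in S} \mathrm{CW}(X_{s}) = \mathrm{CW}\Bigl(\bigcap_{s\in S} X_{s}\Bigr).$$
   Context: All maps are continuous. The factorization applied to $\emptyset\to X$. Construct a sequence $\emptyset=A_{-1}\to A_0\to A_1\to\cdots$ of spaces with compatible maps to $X$ as follows. Let $A_0=\coprod_{D^0\to X}D^0$, a discrete space with one point for each map $D^0\to X$, each point being mapped to $X$ by its indexing map. For $n\ge 1$, given $A_{n-1}\to X$, let $A_n$ be obtained from $A_{n-1}$ by attaching one $n$-cell for each commutative square $$\begin{array}{ccc} S^{n-1} & \xrightarrow{\alpha} & A_{n-1}\\ \downarrow & & \downarrow\\ D^{n} & \xrightarrow{\beta} & X\end{array}$$ (left map the standard inclusion), the cell being attached along $\alpha$ and mapped to $X$ by $\beta$; that is, $A_n$ is the pushout of $\coprod D^n\leftarrow\coprod S^{n-1}\to A_{n-1}$, coproducts over all such squares. Then $\mathrm{CW}(X)=\operatorname{colim}_n A_n$, a CW-complex with $n$-skeleton $A_n$, equipped with the induced map to $X$. Functoriality. A map $g\colon X\to X'$ induces maps $f_n\colon A_n\to A'_n$ between the corresponding stages for $X$ and $X'$: $f_0$ sends the point indexed by $\alpha\colon D^0\to X$ to the point indexed by $g\circ\alpha$,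 and $f_n$ extends $f_{n-1}$ by sending the $n$-cell indexed by $(\alpha,\beta)$ identically to the $n$-cell indexed by $(f_{n-1}\circ\alpha,\,g\circ\beta)$. The induced map $\mathrm{CW}(X)\to\mathrm{CW}(X')$ is $\operatorname{colim}_n f_n$. For a subspace $Y\subseteq X$, $\mathrm{CW}(Y)$ is regarded as a subcomplex of $\mathrm{CW}(X)$ via the map $\mathrm{CW}(Y)\to\mathrm{CW}(X)$ induced by the inclusion (part of the assertion for $Y = X_s$ is that this map is the inclusion of a subcomplex); the displayed equality is an equality of subcomplexes of $\mathrm{CW}(X)$. Intersections are taken inside $X$ and inside $\mathrm{CW}(X)$ respectively (so an empty intersection is the whole of $X$, respectively $\mathrm{CW}(X)$). *)

theory Defs
  imports "HOL-Analysis.Analysis"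
begin

section \<open>Discs, spheres and continuous maps\<close>

text \<open>
  As for \<^const>\<open>nsphere\<close>, the points of the disc are the sequences that vanish from index n on,
  so the boundary sphere of the disc of dimension n + 1 is \<open>nsphere n\<close>.
\<close>

definition ndisc :: "nat \<Rightarrow> (nat \<Rightarrow> real) topology" where
  "ndisc n = subtopology (Euclidean_space n) {x. (\<Sum>i<n. (x i)\<^sup>2) \<le> 1}"

definition ndisc_interior :: "nat \<Rightarrow> (nat \<Rightarrow> real) set" where
  "ndisc_interior n = {x \<in> topspace (ndisc n). (\<Sum>i<n. (x i)\<^sup>2) < 1}"

text \<open>
  Extensionality makes a continuous map a single HOL function, so that distinct indices of cells
  are distinct maps.
\<close>

definition cmaps :: "'a topology \<Rightarrow> 'b topology \<Rightarrow> ('a \<Rightarrow> 'b) set" where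
  "cmaps X Y = {f. continuous_map X Y f} \<inter> extensional (topspace X)"


section \<open>The construction\<close>

text \<open>
  \<open>Vertex \<beta>\<close> is the point indexed by \<open>\<beta>\<close>, a map from the 0-disc to X.
  \<open>Cell n \<alpha> \<beta> x\<close> is the point x of the open n-cell indexed by the square \<open>(\<alpha>, \<beta>)\<close>.
  The pushout \<open>A\<^sub>n\<close> is realised on the set obtained from \<open>A\<^sub>n\<^sub>-\<^sub>1\<close> by adjoining the interiors of
  the new discs, so that the maps \<open>A\<^sub>n\<^sub>-\<^sub>1 \<rightarrow> A\<^sub>n\<close> are inclusions of sets.
\<close>

datatype 'a cw_point =
    Vertex "(nat \<Rightarrow> real) \<Rightarrow> 'a"
  | Cell nat "(nat \<Rightarrow> real) \<Rightarrow> 'a cw_point" "(nat \<Rightarrow> real) \<Rightarrow> 'a" "nat \<Rightarrow> real"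

text \<open>The map to X; the only point of the 0-disc is the zero sequence.\<close>

primrec cw_proj :: "'a cw_point \<Rightarrow> 'a" where
  "cw_proj (Vertex \<beta>) = \<beta> (\<lambda>_. 0)"
| "cw_proj (Cell n \<alpha> \<beta> x) = \<beta> x"

text \<open>The map from the disc of dimension \<open>Suc n\<close> to the pushout, for the cell indexed by \<open>(\<alpha>, \<beta>)\<close>.\<close>

definition cell_map ::
  "nat \<Rightarrow> ((nat \<Rightarrow> real) \<Rightarrow> 'a cw_point) \<Rightarrow> ((nat \<Rightarrow> real) \<Rightarrow> 'a) \<Rightarrow> (nat \<Rightarrow> real) \<Rightarrow> 'a cw_point" where
  "cell_map n \<alpha> \<beta> x = (if x \<in> topspace (nsphere n) then \<alpha> x else Cell (Suc n) \<alpha> \<beta> x)"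

definition squares ::
  "'a topology \<Rightarrow> 'a cw_point topology \<Rightarrow> nat \<Rightarrow>
     (((nat \<Rightarrow> real) \<Rightarrow> 'a cw_point) \<times> ((nat \<Rightarrow> real) \<Rightarrow> 'a)) set" where
  "squares X A n = {(\<alpha>, \<beta>). \<alpha> \<in> cmaps (nsphere n) A \<and> \<beta> \<in> cmaps (ndisc (Suc n)) X \<and>
     (\<forall>x \<in> topspace (nsphere n). cw_proj (\<alpha> x) = \<beta> x)}"

text \<open>
  The pushout topology: the finest one for which the inclusion of A and all the maps
  \<^const>\<open>cell_map\<close> are continuous.
\<close>

definition attach_cells ::
  "'a cw_point topology \<Rightarrow> nat \<Rightarrow>
     (((nat \<Rightarrow> real) \<Rightarrow> 'a cw_point) \<times> ((nat \<Rightarrow> real) \<Rightarrow> 'a)) set \<Rightarrow> 'a cw_point topology" where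
  "attach_cells A n Q = topology (\<lambda>U.
     U \<subseteq> topspace A \<union> (\<Union>(\<alpha>, \<beta>) \<in> Q. Cell (Suc n) \<alpha> \<beta> ` ndisc_interior (Suc n)) \<and>
     openin A (U \<inter> topspace A) \<and>
     (\<forall>(\<alpha>, \<beta>) \<in> Q.
        openin (ndisc (Suc n)) {x \<in> topspace (ndisc (Suc n)). cell_map n \<alpha> \<beta> x \<in> U}))"

primrec cw_stage :: "'a topology \<Rightarrow> nat \<Rightarrow> 'a cw_point topology" where
  "cw_stage X 0 = discrete_topology (Vertex ` cmaps (ndisc 0) X)"
| "cw_stage X (Suc n) = attach_cells (cw_stage X n) n (squares X (cw_stage X n) n)"

definition CW :: "'a topology \<Rightarrow> 'a cw_point topology" where
  "CW X = topology (\<lambda>U. U \<subseteq> (\<Union>n. topspace (cw_stage X n)) \<and>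
     (\<forall>n. openin (cw_stage X n) (U \<inter> topspace (cw_stage X n))))"

text \<open>The open cells of dimension n.\<close>

definition CW_cells :: "'a topology \<Rightarrow> nat \<Rightarrow> 'a cw_point set set" where
  "CW_cells X n = (case n of
     0 \<Rightarrow> (\<lambda>v. {v}) ` topspace (cw_stage X 0)
   | Suc m \<Rightarrow> (\<lambda>(\<alpha>, \<beta>). Cell (Suc m) \<alpha> \<beta> ` ndisc_interior (Suc m)) ` squares X (cw_stage X m) m)"

text \<open>
  The map induced by g, for all stages at once.  In a point \<open>Cell n \<alpha> \<beta> x\<close> of a stage we have
  \<open>n > 0\<close>, and \<open>\<alpha>\<close> is defined on \<open>nsphere (n - 1)\<close>.
\<close>

primrec CW_map :: "('a \<Rightarrow> 'b) \<Rightarrow> 'a cw_point \<Rightarrow> 'b cw_point" where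
  "CW_map g (Vertex \<beta>) = Vertex (restrict (g \<circ> \<beta>) (topspace (ndisc 0)))"
| "CW_map g (Cell n \<alpha> \<beta> x) =
     Cell n (restrict (CW_map g \<circ> \<alpha>) (topspace (nsphere (n - 1))))
       (restrict (g \<circ> \<beta>) (topspace (ndisc n))) x"


section \<open>Subcomplexes\<close>

text \<open>A complex is given by a space K and its open cells, where \<open>C n\<close> is the set of the n-cells.\<close>

definition subcomplex :: "'a topology \<Rightarrow> (nat \<Rightarrow> 'a set set) \<Rightarrow> 'a set \<Rightarrow> bool" where
  "subcomplex K C L \<longleftrightarrow> closedin K L \<and> (\<exists>E \<subseteq> (\<Union>n. C n). L = \<Union>E)"

definition subcomplex_inclusion ::
  "'a topology \<Rightarrow> (nat \<Rightarrow> 'a set set) \<Rightarrow> 'b topology \<Rightarrow> (nat \<Rightarrow> 'b set set) \<Rightarrow> ('a \<Rightarrow> 'b) \<Rightarrow> bool" where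
  "subcomplex_inclusion K C K' C' f \<longleftrightarrow>
     embedding_map K K' f \<and> subcomplex K' C' (f ` topspace K) \<and>
     (\<forall>n. \<forall>e \<in> C n. f ` e \<in> C' n)"

text \<open>
  For a subspace Y of X: the map from \<open>CW(Y)\<close> to \<open>CW(X)\<close> induced by the inclusion (which is the
  identity on elements of the type), and the subset of \<open>CW(X)\<close> given by its image.
\<close>

abbreviation CW_incl :: "'a cw_point \<Rightarrow> 'a cw_point" where
  "CW_incl \<equiv> CW_map (\<lambda>x. x)"

definition CW_sub :: "'a topology \<Rightarrow> 'a set \<Rightarrow> 'a cw_point set" where
  "CW_sub X Y = CW_incl ` topspace (CW (subtopology X Y))"


section \<open>The topologies above are the intended ones\<close>

lemma nsphere_subset_ndisc: "topspace (nsphere n) \<subseteq> topspace (ndisc (Suc n))"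
  by (auto simp: nsphere_def ndisc_def lessThan_Suc_atMost)

lemma ndisc_interior_eq: "ndisc_interior (Suc n) = topspace (ndisc (Suc n)) - topspace (nsphere n)"
  by (auto simp: nsphere_def ndisc_def ndisc_interior_def lessThan_Suc_atMost)

lemma openin_attach_cells:
  "openin (attach_cells A n Q) U \<longleftrightarrow>
     U \<subseteq> topspace A \<union> (\<Union>(\<alpha>, \<beta>) \<in> Q. Cell (Suc n) \<alpha> \<beta> ` ndisc_interior (Suc n)) \<and>
     openin A (U \<inter> topspace A) \<and>
     (\<forall>(\<alpha>, \<beta>) \<in> Q.
        openin (ndisc (Suc n)) {x \<in> topspace (ndisc (Suc n)). cell_map n \<alpha> \<beta> x \<in> U})"
proof -
  let ?D = "ndisc (Suc n)"
  let ?P = "\<lambda>U. U \<subseteq> topspace A \<union> (\<Union>(\<alpha>, \<beta>) \<in> Q. Cell (Suc n) \<alpha> \<beta> ` ndisc_interior (Suc n)) \<and>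
     openin A (U \<inter> topspace A) \<and>
     (\<forall>(\<alpha>, \<beta>) \<in> Q. openin ?D {x \<in> topspace ?D. cell_map n \<alpha> \<beta> x \<in> U})"
  have "istopology ?P"
    unfolding istopology_def
  proof (intro conjI allI impI)
    fix S T assume S: "?P S" and T: "?P T"
    have 1: "openin A ((S \<inter> T) \<inter> topspace A)"
    proof -
      have "(S \<inter> T) \<inter> topspace A = (S \<inter> topspace A) \<inter> (T \<inter> topspace A)" by blast
      then show ?thesis using S T by (simp only: openin_Int)
    qed
    have 2: "openin ?D {x \<in> topspace ?D. cell_map n \<alpha> \<beta> x \<in> S \<inter> T}" if "(\<alpha>, \<beta>) \<in> Q" for \<alpha> \<beta>
    proof -
      have "{x \<in> topspace ?D. cell_map n \<alpha> \<beta> x \<in> S \<inter> T} =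
        {x \<in> topspace ?D. cell_map n \<alpha> \<beta> x \<in> S} \<inter> {x \<in> topspace ?D. cell_map n \<alpha> \<beta> x \<in> T}" by blast
      moreover have "openin ?D {x \<in> topspace ?D. cell_map n \<alpha> \<beta> x \<in> S}"
        "openin ?D {x \<in> topspace ?D. cell_map n \<alpha> \<beta> x \<in> T}" using S T that by blast+
      ultimately show ?thesis by (simp only: openin_Int)
    qed
    show "S \<inter> T \<subseteq> topspace A \<union> (\<Union>(\<alpha>, \<beta>) \<in> Q. Cell (Suc n) \<alpha> \<beta> ` ndisc_interior (Suc n))"
      using S by blast
    show "openin A ((S \<inter> T) \<inter> topspace A)" by (fact 1)
    show "\<forall>(\<alpha>, \<beta>) \<in> Q. openin ?D {x \<in> topspace ?D. cell_map n \<alpha> \<beta> x \<in> S \<inter> T}"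
      using 2 by blast
  next
    fix \<K> assume K: "\<forall>S\<in>\<K>. ?P S"
    have 1: "openin A (\<Union>\<K> \<inter> topspace A)"
    proof -
      have "\<Union>\<K> \<inter> topspace A = (\<Union>S\<in>\<K>. S \<inter> topspace A)" by blast
      moreover have "openin A (\<Union>S\<in>\<K>. S \<inter> topspace A)"
        by (rule openin_Union) (use K in auto)
      ultimately show ?thesis by simp
    qed
    have 2: "openin ?D {x \<in> topspace ?D. cell_map n \<alpha> \<beta> x \<in> \<Union>\<K>}" if "(\<alpha>, \<beta>) \<in> Q" for \<alpha> \<beta>
    proof -
      have "{x \<in> topspace ?D. cell_map n \<alpha> \<beta> x \<in> \<Union>\<K>} =
        (\<Union>S\<in>\<K>. {x \<in> topspace ?D. cell_map n \<alpha> \<beta> x \<in> S})" by blast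
      moreover have "openin ?D (\<Union>S\<in>\<K>. {x \<in> topspace ?D. cell_map n \<alpha> \<beta> x \<in> S})"
        by (rule openin_Union) (use K that in auto)
      ultimately show ?thesis by simp
    qed
    show "\<Union>\<K> \<subseteq> topspace A \<union> (\<Union>(\<alpha>, \<beta>) \<in> Q. Cell (Suc n) \<alpha> \<beta> ` ndisc_interior (Suc n))"
      using K by blast
    show "openin A (\<Union>\<K> \<inter> topspace A)" by (fact 1)
    show "\<forall>(\<alpha>, \<beta>) \<in> Q. openin ?D {x \<in> topspace ?D. cell_map n \<alpha> \<beta> x \<in> \<Union>\<K>}"
      using 2 by blast
  qed
  then show ?thesis
    unfolding attach_cells_def by (simp add: topology_inverse')
qed

lemma topspace_attach_cells:
  assumes "\<And>\<alpha> \<beta>. (\<alpha>, \<beta>) \<in> Q \<Longrightarrow> \<alpha> ` topspace (nsphere n) \<subseteq> topspace A"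
  shows "topspace (attach_cells A n Q) =
    topspace A \<union> (\<Union>(\<alpha>, \<beta>) \<in> Q. Cell (Suc n) \<alpha> \<beta> ` ndisc_interior (Suc n))" (is "_ = ?P")
proof -
  have "cell_map n \<alpha> \<beta> x \<in> ?P" if "(\<alpha>, \<beta>) \<in> Q" "x \<in> topspace (ndisc (Suc n))" for \<alpha> \<beta> x
    using that assms[OF that(1)] by (force simp: cell_map_def ndisc_interior_eq)
  then have "{x \<in> topspace (ndisc (Suc n)). cell_map n \<alpha> \<beta> x \<in> ?P} = topspace (ndisc (Suc n))"
    if "(\<alpha>, \<beta>) \<in> Q" for \<alpha> \<beta>
    using that by blast
  then have "\<forall>(\<alpha>, \<beta>) \<in> Q. openin (ndisc (Suc n)) {x \<in> topspace (ndisc (Suc n)). cell_map n \<alpha> \<beta> x \<in> ?P}"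
    by (metis (no_types, lifting) case_prodI2 openin_topspace)
  moreover have "?P \<inter> topspace A = topspace A" by blast
  ultimately have "openin (attach_cells A n Q) ?P"
    unfolding openin_attach_cells by (metis (no_types, lifting) order_refl openin_topspace)
  moreover have "topspace (attach_cells A n Q) \<subseteq> ?P"
    using openin_topspace[of "attach_cells A n Q"] unfolding openin_attach_cells by blast
  ultimately show ?thesis
    by (metis openin_subset subset_antisym)
qed

text \<open>The universal property of the pushout.\<close>

lemma continuous_map_attach_cells:
  assumes Q: "\<And>\<alpha> \<beta>. (\<alpha>, \<beta>) \<in> Q \<Longrightarrow> \<alpha> ` topspace (nsphere n) \<subseteq> topspace A"
  shows "continuous_map (attach_cells A n Q) Z h \<longleftrightarrow>
    continuous_map A Z h \<and>
    (\<forall>(\<alpha>, \<beta>) \<in> Q. continuous_map (ndisc (Suc n)) Z (h \<circ> cell_map n \<alpha> \<beta>))"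
proof -
  let ?P = "topspace (attach_cells A n Q)" and ?D = "ndisc (Suc n)"
  have P: "?P = topspace A \<union> (\<Union>(\<alpha>, \<beta>) \<in> Q. Cell (Suc n) \<alpha> \<beta> ` ndisc_interior (Suc n))"
    using Q by (rule topspace_attach_cells)
  have c: "cell_map n \<alpha> \<beta> x \<in> ?P" if "(\<alpha>, \<beta>) \<in> Q" "x \<in> topspace ?D" for \<alpha> \<beta> x
    unfolding P using that Q[OF that(1)] by (force simp: cell_map_def ndisc_interior_eq)
  have i: "Cell (Suc n) \<alpha> \<beta> x = cell_map n \<alpha> \<beta> x \<and> x \<in> topspace ?D"
    if "x \<in> ndisc_interior (Suc n)" for \<alpha> \<beta> x
    using that by (auto simp: cell_map_def ndisc_interior_eq)
  have "h \<in> ?P \<rightarrow> topspace Z \<longleftrightarrow> h \<in> topspace A \<rightarrow> topspace Z \<and>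
      (\<forall>(\<alpha>, \<beta>) \<in> Q. h \<circ> cell_map n \<alpha> \<beta> \<in> topspace ?D \<rightarrow> topspace Z)" (is "?L \<longleftrightarrow> ?R")
  proof
    assume ?L then show ?R using c P by fastforce
  next
    assume R: ?R
    show ?L
    proof
      fix p assume "p \<in> ?P"
      then consider "p \<in> topspace A"
        | \<alpha> \<beta> x where "(\<alpha>, \<beta>) \<in> Q" "x \<in> ndisc_interior (Suc n)" "p = Cell (Suc n) \<alpha> \<beta> x"
        unfolding P by blast
      then show "h p \<in> topspace Z"
      proof cases
        case 1 then show ?thesis using R by auto
      next
        case 2
        then have "h \<circ> cell_map n \<alpha> \<beta> \<in> topspace ?D \<rightarrow> topspace Z" using R by blast
        then have "(h \<circ> cell_map n \<alpha> \<beta>) x \<in> topspace Z" using i[OF 2(2), of \<alpha> \<beta>] by blast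
        then show ?thesis using i[OF 2(2), of \<alpha> \<beta>] 2(3) by simp
      qed
    qed
  qed
  moreover have "openin (attach_cells A n Q) {p \<in> ?P. h p \<in> U} \<longleftrightarrow>
      openin A {p \<in> topspace A. h p \<in> U} \<and>
      (\<forall>(\<alpha>, \<beta>) \<in> Q. openin ?D {x \<in> topspace ?D. (h \<circ> cell_map n \<alpha> \<beta>) x \<in> U})" for U
  proof -
    have "{p \<in> ?P. h p \<in> U} \<inter> topspace A = {p \<in> topspace A. h p \<in> U}" using P by blast
    moreover have "{x \<in> topspace ?D. cell_map n \<alpha> \<beta> x \<in> {p \<in> ?P. h p \<in> U}} =
      {x \<in> topspace ?D. (h \<circ> cell_map n \<alpha> \<beta>) x \<in> U}" if "(\<alpha>, \<beta>) \<in> Q" for \<alpha> \<beta>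
      using c[OF that] by auto
    moreover have "{p \<in> ?P. h p \<in> U} \<subseteq>
      topspace A \<union> (\<Union>(\<alpha>, \<beta>) \<in> Q. Cell (Suc n) \<alpha> \<beta> ` ndisc_interior (Suc n))"
      using P by blast
    ultimately show ?thesis
      unfolding openin_attach_cells by (auto simp: split_beta)
  qed
  ultimately show ?thesis
    unfolding continuous_map_def by (auto simp: split_beta)
qed

lemma openin_CW:
  "openin (CW X) U \<longleftrightarrow> U \<subseteq> (\<Union>n. topspace (cw_stage X n)) \<and>
     (\<forall>n. openin (cw_stage X n) (U \<inter> topspace (cw_stage X n)))"
proof -
  have "istopology (\<lambda>U. U \<subseteq> (\<Union>n. topspace (cw_stage X n)) \<and>
     (\<forall>n. openin (cw_stage X n) (U \<inter> topspace (cw_stage X n))))"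
    unfolding istopology_def
  proof (intro conjI allI impI)
    fix S T n
    assume "S \<subseteq> (\<Union>n. topspace (cw_stage X n)) \<and>
        (\<forall>n. openin (cw_stage X n) (S \<inter> topspace (cw_stage X n)))"
      "T \<subseteq> (\<Union>n. topspace (cw_stage X n)) \<and>
        (\<forall>n. openin (cw_stage X n) (T \<inter> topspace (cw_stage X n)))"
    then have "openin (cw_stage X n) ((S \<inter> topspace (cw_stage X n)) \<inter> (T \<inter> topspace (cw_stage X n)))"
      by blast
    moreover have "(S \<inter> topspace (cw_stage X n)) \<inter> (T \<inter> topspace (cw_stage X n)) =
      (S \<inter> T) \<inter> topspace (cw_stage X n)" by blast
    ultimately show "openin (cw_stage X n) (S \<inter> T \<inter> topspace (cw_stage X n))" by simp
  next
    fix \<K> n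
    assume K: "\<forall>S\<in>\<K>. S \<subseteq> (\<Union>n. topspace (cw_stage X n)) \<and>
        (\<forall>n. openin (cw_stage X n) (S \<inter> topspace (cw_stage X n)))"
    have "openin (cw_stage X n) (\<Union>S\<in>\<K>. S \<inter> topspace (cw_stage X n))"
      by (rule openin_Union) (use K in auto)
    moreover have "(\<Union>S\<in>\<K>. S \<inter> topspace (cw_stage X n)) = \<Union>\<K> \<inter> topspace (cw_stage X n)" by blast
    ultimately show "openin (cw_stage X n) (\<Union>\<K> \<inter> topspace (cw_stage X n))" by simp
  qed blast+
  then show ?thesis
    unfolding CW_def by (simp add: topology_inverse')
qed

end

theory Submission
  imports Defs
begin

text \<open>
  On the points of \<open>CW(Y)\<close> the induced map \<^const>\<open>CW_incl\<close> is the identity, so everything takes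
  place inside \<open>CW(X)\<close>.  The square \<open>(\<alpha>, \<beta>)\<close> of X is a square of Y exactly if \<open>\<alpha>\<close> takes values
  in the preceding stage of Y and \<open>\<beta>\<close> takes values in Y; both conditions commute with
  intersections.  Inductively every stage of Y is a closed subspace of the stage of X: a new cell
  that does not belong to Y meets a set C of points of \<open>CW(Y)\<close> only along its boundary sphere,
  which is closed in the disc, and there the preimage of C is closed because \<open>\<alpha>\<close> is continuous.
\<close>

section \<open>Closed subspaces, spheres in discs, squares of a subspace\<close>

text \<open>A topology is determined by its closed sets. One assumption makes each closed set of
  \<open>T'\<close> the trace of a closed set of \<open>T\<close>, namely of itself; the other makes
  every such trace closed in \<open>T'\<close>.\<close>

lemma closed_subspace_eqI:
  assumes "\<And>C. closedin T' C \<Longrightarrow> closedin T C"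
    and "\<And>C. closedin T C \<Longrightarrow> closedin T' (C \<inter> topspace T')"
  shows "T' = subtopology T (topspace T')"
proof -
  have sub: "topspace T' \<subseteq> topspace T"
    using assms(1)[OF closedin_topspace] by (rule closedin_subset)
  have "closedin T' C \<longleftrightarrow> closedin (subtopology T (topspace T')) C" for C
    unfolding closedin_subtopology using assms closedin_subset by (metis inf.orderE)
  moreover have "topspace (subtopology T (topspace T')) = topspace T'"
    using sub by (rule topspace_subtopology_subset)
  ultimately show ?thesis
    unfolding topology_eq by (simp add: openin_closedin_eq)
qed

text \<open>Together with \<open>subtopology_nsphere\<close> this makes closed subsets of the sphere
  closed in the disc.\<close>

lemma closedin_nsphere: "closedin (ndisc (Suc n)) (topspace (nsphere n))"
proof -
  have "nsphere n = subtopology (ndisc (Suc n)) {x. (\<Sum>i\<le>n. (x i)\<^sup>2) = 1}"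
    by (auto simp: nsphere_def ndisc_def subtopology_subtopology lessThan_Suc_atMost
        intro: arg_cong[where f = "subtopology _"])
  then have "topspace (nsphere n) = {x \<in> topspace (ndisc (Suc n)). (\<Sum>i\<le>n. (x i)\<^sup>2) \<in> {1}}"
    by auto
  moreover have "continuous_map (powertop_real UNIV) euclideanreal (\<lambda>x. \<Sum>i\<le>n. (x i)\<^sup>2)"
    by (intro continuous_intros) auto
  then have "continuous_map (ndisc (Suc n)) euclideanreal (\<lambda>x. \<Sum>i\<le>n. (x i)\<^sup>2)"
    unfolding ndisc_def Euclidean_space_def by (intro continuous_map_from_subtopology)
  then have "closedin (ndisc (Suc n)) {x \<in> topspace (ndisc (Suc n)). (\<Sum>i\<le>n. (x i)\<^sup>2) \<in> {1}}"
    by (rule closedin_continuous_map_preimage) simp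
  ultimately show ?thesis by simp
qed

lemma subtopology_nsphere: "subtopology (ndisc (Suc n)) (topspace (nsphere n)) = nsphere n"
proof -
  have "{x. (\<Sum>i\<le>n. (x i)\<^sup>2) \<le> 1} \<inter> (topspace (Euclidean_space (Suc n)) \<inter> {x. (\<Sum>i\<le>n. (x i)\<^sup>2) = 1})
    = topspace (Euclidean_space (Suc n)) \<inter> {x. (\<Sum>i\<le>n. (x i)\<^sup>2) = (1::real)}" by auto
  then show ?thesis
    unfolding nsphere_def ndisc_def subtopology_subtopology lessThan_Suc_atMost topspace_subtopology
    by (metis subtopology_restrict)
qed

lemma cmaps_funcset: "f \<in> cmaps Z X \<Longrightarrow> f \<in> topspace Z \<rightarrow> topspace X"
  using continuous_map_funspace by (auto simp: cmaps_def)

text \<open>Extensionality concerns only the domain, so a map into the subspace is literally the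
  same function as a map into X. Hence cells of CW(Y) carry the same indices as cells of
  CW(X).\<close>

lemma cmaps_subtopology: "cmaps Z (subtopology X Y) = {f \<in> cmaps Z X. f \<in> topspace Z \<rightarrow> Y}"
  by (auto simp: cmaps_def continuous_map_in_subtopology)

text \<open>\<open>cw_proj\<close> does not mention the space X, so commutativity of a square is the
  same condition for both.\<close>

lemma squares_subtopology:
  "squares (subtopology X Y) (subtopology A B) n =
    {(\<alpha>, \<beta>) \<in> squares X A n. \<alpha> \<in> topspace (nsphere n) \<rightarrow> B \<and> \<beta> \<in> topspace (ndisc (Suc n)) \<rightarrow> Y}"
  by (auto simp: squares_def cmaps_subtopology)

lemma squares_boundary:
  assumes "(\<alpha>, \<beta>) \<in> squares X A n"
  shows "continuous_map (nsphere n) A \<alpha>" "\<alpha> ` topspace (nsphere n) \<subseteq> topspace A"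
proof -
  show "continuous_map (nsphere n) A \<alpha>" using assms by (simp add: squares_def cmaps_def)
  then show "\<alpha> ` topspace (nsphere n) \<subseteq> topspace A" by (rule continuous_map_image_subset_topspace)
qed

section \<open>Attaching cells over a closed subspace\<close>

text \<open>Each \<open>cell_map\<close> sends its whole disc into the attached space, so preimages
  of complements are complements of preimages.\<close>

lemma closedin_attach_cells:
  assumes Q: "\<And>\<alpha> \<beta>. (\<alpha>, \<beta>) \<in> Q \<Longrightarrow> \<alpha> ` topspace (nsphere n) \<subseteq> topspace A"
  shows "closedin (attach_cells A n Q) C \<longleftrightarrow>
     C \<subseteq> topspace (attach_cells A n Q) \<and> closedin A (C \<inter> topspace A) \<and>
     (\<forall>(\<alpha>, \<beta>) \<in> Q.
        closedin (ndisc (Suc n)) {x \<in> topspace (ndisc (Suc n)). cell_map n \<alpha> \<beta> x \<in> C})"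
proof -
  let ?P = "topspace (attach_cells A n Q)" and ?D = "ndisc (Suc n)"
  have P: "?P = topspace A \<union> (\<Union>(\<alpha>, \<beta>) \<in> Q. Cell (Suc n) \<alpha> \<beta> ` ndisc_interior (Suc n))"
    using Q by (rule topspace_attach_cells)
  have c: "cell_map n \<alpha> \<beta> x \<in> ?P" if "(\<alpha>, \<beta>) \<in> Q" "x \<in> topspace ?D" for \<alpha> \<beta> x
    unfolding P using that Q[OF that(1)] by (force simp: cell_map_def ndisc_interior_eq)
  have 1: "openin A ((?P - C) \<inter> topspace A) \<longleftrightarrow> closedin A (C \<inter> topspace A)"
  proof -
    have "(?P - C) \<inter> topspace A = topspace A - C \<inter> topspace A" using P by blast
    then show ?thesis by (simp add: closedin_def)
  qed
  have 2: "openin ?D {x \<in> topspace ?D. cell_map n \<alpha> \<beta> x \<in> ?P - C} \<longleftrightarrow>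
      closedin ?D {x \<in> topspace ?D. cell_map n \<alpha> \<beta> x \<in> C}" if "(\<alpha>, \<beta>) \<in> Q" for \<alpha> \<beta>
  proof -
    have "{x \<in> topspace ?D. cell_map n \<alpha> \<beta> x \<in> ?P - C} =
        topspace ?D - {x \<in> topspace ?D. cell_map n \<alpha> \<beta> x \<in> C}" using c[OF that] by blast
    then show ?thesis by (simp add: closedin_def)
  qed
  have "?P - C \<subseteq> topspace A \<union> (\<Union>(\<alpha>, \<beta>) \<in> Q. Cell (Suc n) \<alpha> \<beta> ` ndisc_interior (Suc n))"
    using P by blast
  then show ?thesis
    unfolding closedin_def[of "attach_cells A n Q"] openin_attach_cells[of _ _ _ "?P - C"] 1
    using 2 by blast
qed

text \<open>Separates newly attached cells from older points: for a point of the complex, this is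
  the number of the first stage that contains it.\<close>

primrec cw_dim :: "'a cw_point \<Rightarrow> nat" where
  "cw_dim (Vertex \<beta>) = 0"
| "cw_dim (Cell n \<alpha> \<beta> x) = n"

text \<open>The inductive step: \<open>A\<close> is to be a stage of X, \<open>B\<close> the same
  stage of Y, \<open>Q'\<close> the squares of Y. By \<open>dim\<close> the new open cells are
  disjoint from \<open>A\<close>; as \<open>B\<close> is closed, closed sets of \<open>B\<close> are
  closed in \<open>A\<close>.\<close>

lemma attach_cells_closed_subspace:
  assumes dim: "\<And>p. p \<in> topspace A \<Longrightarrow> cw_dim p \<le> n"
    and B: "closedin A B"
    and Q: "\<And>\<alpha> \<beta>. (\<alpha>, \<beta>) \<in> Q \<Longrightarrow> continuous_map (nsphere n) A \<alpha>"
    and sub: "Q' \<subseteq> Q"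
    and Q': "\<And>\<alpha> \<beta>. (\<alpha>, \<beta>) \<in> Q' \<Longrightarrow> \<alpha> ` topspace (nsphere n) \<subseteq> B"
  defines "T \<equiv> attach_cells A n Q"
    and "T' \<equiv> attach_cells (subtopology A B) n Q'"
  shows "T' = subtopology T (topspace T')" "closedin T (topspace T')"
proof -
  let ?D = "ndisc (Suc n)"
  have BA: "B \<subseteq> topspace A" using B by (rule closedin_subset)
  have topB: "topspace (subtopology A B) = B" using BA by (rule topspace_subtopology_subset)
  have img: "\<alpha> ` topspace (nsphere n) \<subseteq> topspace A" if "(\<alpha>, \<beta>) \<in> Q" for \<alpha> \<beta>
    using Q[OF that] by (rule continuous_map_image_subset_topspace)
  have T: "topspace T = topspace A \<union> (\<Union>(\<alpha>, \<beta>) \<in> Q. Cell (Suc n) \<alpha> \<beta> ` ndisc_interior (Suc n))"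
    unfolding T_def using img by (rule topspace_attach_cells)
  have T': "topspace T' = B \<union> (\<Union>(\<alpha>, \<beta>) \<in> Q'. Cell (Suc n) \<alpha> \<beta> ` ndisc_interior (Suc n))"
    unfolding T'_def by (rule topspace_attach_cells[of Q' n "subtopology A B", unfolded topB]) (rule Q')
  have clT: "closedin T C \<longleftrightarrow> C \<subseteq> topspace T \<and> closedin A (C \<inter> topspace A) \<and>
      (\<forall>(\<alpha>, \<beta>) \<in> Q. closedin ?D {x \<in> topspace ?D. cell_map n \<alpha> \<beta> x \<in> C})" for C
    unfolding T_def using img by (rule closedin_attach_cells)
  have clT': "closedin T' C \<longleftrightarrow> C \<subseteq> topspace T' \<and> closedin (subtopology A B) (C \<inter> B) \<and>
      (\<forall>(\<alpha>, \<beta>) \<in> Q'. closedin ?D {x \<in> topspace ?D. cell_map n \<alpha> \<beta> x \<in> C})" for C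
    unfolding T'_def by (rule closedin_attach_cells[of Q' n "subtopology A B", unfolded topB]) (rule Q')
  have new: "Cell (Suc n) \<alpha> \<beta> x \<notin> topspace A" for \<alpha> \<beta> x
    using dim[of "Cell (Suc n) \<alpha> \<beta> x"] by auto
  have T'A: "topspace T' \<inter> topspace A = B" using T' BA new by auto
  have T'T: "topspace T' \<subseteq> topspace T" unfolding T T' using BA sub by (intro Un_mono UN_mono) auto
  have "closedin T C" if "closedin T' C" for C
  proof (subst clT, intro conjI ballI, safe)
    from that have C: "C \<subseteq> topspace T'" "closedin (subtopology A B) (C \<inter> B)"
      and cells: "\<And>\<alpha> \<beta>. (\<alpha>, \<beta>) \<in> Q' \<Longrightarrow> closedin ?D {x \<in> topspace ?D. cell_map n \<alpha> \<beta> x \<in> C}"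
      unfolding clT' by blast+
    show "p \<in> topspace T" if "p \<in> C" for p
      using C(1) T'T that by blast
    have CA: "C \<inter> topspace A = C \<inter> B" using C(1) T'A by blast
    show cl: "closedin A (C \<inter> topspace A)"
      unfolding CA using C(2) B closedin_trans_full by blast
    show "closedin ?D {x \<in> topspace ?D. cell_map n \<alpha> \<beta> x \<in> C}" if "(\<alpha>, \<beta>) \<in> Q" for \<alpha> \<beta>
    proof (cases "(\<alpha>, \<beta>) \<in> Q'")
      case True then show ?thesis by (rule cells)
    next
      case False
      \<comment> \<open>By injectivity of \<open>Cell\<close>, such a point comes from no square in
        \<open>Q'\<close>; by \<open>new\<close> it is not in \<open>B\<close> either.\<close>
      have "Cell (Suc n) \<alpha> \<beta> x \<notin> C" for x
        using False C(1) T' BA new[of \<alpha> \<beta> x] by auto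
      \<comment> \<open>Only boundary points remain. Cutting \<open>C\<close> down to
        \<open>topspace A\<close> gives the set that \<open>cl\<close> shows to be closed.\<close>
      then have "{x \<in> topspace ?D. cell_map n \<alpha> \<beta> x \<in> C} =
          {x \<in> topspace (nsphere n). \<alpha> x \<in> C \<inter> topspace A}"
        using img[OF that] nsphere_subset_ndisc[of n] by (auto simp: cell_map_def split: if_splits)
      moreover have "closedin (nsphere n) {x \<in> topspace (nsphere n). \<alpha> x \<in> C \<inter> topspace A}"
        using Q[OF that] cl by (rule closedin_continuous_map_preimage)
      ultimately show ?thesis
        using closedin_trans_full[of ?D "topspace (nsphere n)"] closedin_nsphere
        by (simp add: subtopology_nsphere)
    qed
  qed
  moreover have "closedin T' (C \<inter> topspace T')" if "closedin T C" for C
  proof (subst clT', intro conjI ballI, safe)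
    from that have CA: "closedin A (C \<inter> topspace A)"
      and cells: "\<And>\<alpha> \<beta>. (\<alpha>, \<beta>) \<in> Q \<Longrightarrow> closedin ?D {x \<in> topspace ?D. cell_map n \<alpha> \<beta> x \<in> C}"
      unfolding clT by blast+
    have "C \<inter> topspace T' \<inter> B = (C \<inter> topspace A) \<inter> B" using T' BA by blast
    then show "closedin (subtopology A B) (C \<inter> topspace T' \<inter> B)"
      using CA by (metis closedin_subtopology)
    show "closedin ?D {x \<in> topspace ?D. cell_map n \<alpha> \<beta> x \<in> C \<inter> topspace T'}"
      if q: "(\<alpha>, \<beta>) \<in> Q'" for \<alpha> \<beta>
    proof -
      \<comment> \<open>A cell of \<open>Q'\<close> has its whole image in \<open>T'\<close>, so
        intersecting with \<open>topspace T'\<close> does not change the preimage.\<close>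
      have "cell_map n \<alpha> \<beta> x \<in> topspace T'" if "x \<in> topspace ?D" for x
        unfolding T' using that q Q'[OF q] by (force simp: cell_map_def ndisc_interior_eq)
      then have "{x \<in> topspace ?D. cell_map n \<alpha> \<beta> x \<in> C \<inter> topspace T'} =
          {x \<in> topspace ?D. cell_map n \<alpha> \<beta> x \<in> C}" by blast
      then show ?thesis using cells[of \<alpha> \<beta>] q sub by auto
    qed
  qed
  ultimately show "T' = subtopology T (topspace T')"
    by (rule closed_subspace_eqI)
  show "closedin T (topspace T')"
    using \<open>\<And>C. closedin T' C \<Longrightarrow> closedin T C\<close> closedin_topspace .
qed

section \<open>Stages and their colimit\<close>

lemma topspace_cw_stage_Suc:
  "topspace (cw_stage X (Suc n)) = topspace (cw_stage X n) \<union>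
     (\<Union>(\<alpha>, \<beta>) \<in> squares X (cw_stage X n) n. Cell (Suc n) \<alpha> \<beta> ` ndisc_interior (Suc n))"
  unfolding cw_stage.simps by (rule topspace_attach_cells) (rule squares_boundary(2))

lemma cw_dim_le: "p \<in> topspace (cw_stage X n) \<Longrightarrow> cw_dim p \<le> n"
  by (induction n) (auto simp: topspace_cw_stage_Suc simp del: cw_stage.simps(2))

lemma topspace_CW: "topspace (CW X) = (\<Union>n. topspace (cw_stage X n))"
proof -
  have "(\<Union>n. topspace (cw_stage X n)) \<inter> topspace (cw_stage X m) = topspace (cw_stage X m)" for m
    by blast
  then have "openin (CW X) (\<Union>n. topspace (cw_stage X n))"
    by (simp add: openin_CW)
  moreover have "topspace (CW X) \<subseteq> (\<Union>n. topspace (cw_stage X n))"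
    using openin_topspace[of "CW X"] unfolding openin_CW by blast
  ultimately show ?thesis
    by (metis openin_subset subset_antisym)
qed

text \<open>Each later stage adds only points of its own, larger dimension. So the stages can be
  recovered from the points of the colimit.\<close>

lemma topspace_cw_stage: "topspace (cw_stage X n) = {p \<in> topspace (CW X). cw_dim p \<le> n}"
proof -
  have up: "topspace (cw_stage X m) \<subseteq> topspace (cw_stage X n)" if "m \<le> n" for m n
    using that by (rule lift_Suc_mono_le[rotated]) (use topspace_cw_stage_Suc in blast)
  have down: "p \<in> topspace (cw_stage X (n + k)) \<Longrightarrow> cw_dim p \<le> n \<Longrightarrow> p \<in> topspace (cw_stage X n)"
    for p k
    by (induction k) (auto simp: topspace_cw_stage_Suc simp del: cw_stage.simps(2))
  have "p \<in> topspace (cw_stage X n)" if "p \<in> topspace (cw_stage X m)" "cw_dim p \<le> n" for p m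
    using that up[of m "n + m"] down[of p m] by auto
  then show ?thesis
    using cw_dim_le by (auto simp: topspace_CW)
qed

lemma closedin_CW:
  "closedin (CW X) C \<longleftrightarrow> C \<subseteq> topspace (CW X) \<and>
     (\<forall>n. closedin (cw_stage X n) (C \<inter> topspace (cw_stage X n)))"
proof -
  have "(topspace (CW X) - C) \<inter> topspace (cw_stage X n) =
      topspace (cw_stage X n) - C \<inter> topspace (cw_stage X n)" for n
    by (auto simp: topspace_CW)
  then show ?thesis
    unfolding closedin_def[of "CW X"] openin_CW closedin_def[of "cw_stage X _"]
    by (auto simp: topspace_CW)
qed

section \<open>The complex of a subspace\<close>

text \<open>Both claims go through one induction: the first makes the squares of Y squares of X, the
  second is the closedness of \<open>B\<close> required by
  \<open>attach_cells_closed_subspace\<close>.\<close>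

lemma cw_stage_subtopology:
  fixes X :: "'a topology" and Y :: "'a set" and n :: nat
  defines "A \<equiv> cw_stage X" and "B \<equiv> cw_stage (subtopology X Y)"
  shows "B n = subtopology (A n) (topspace (B n))" "closedin (A n) (topspace (B n))"
proof -
  have "B n = subtopology (A n) (topspace (B n)) \<and> closedin (A n) (topspace (B n))"
  proof (induction n)
    case 0
    \<comment> \<open>Both spaces are discrete, so the inclusion of the sets of vertices
      suffices.\<close>
    have "topspace (B 0) \<subseteq> topspace (A 0)"
      by (auto simp: A_def B_def cmaps_subtopology)
    then show ?case
      by (auto simp: A_def B_def subtopology_discrete_topology Int_absorb1)
  next
    case (Suc n)
    let ?Q = "squares X (A n) n" and ?Q' = "squares (subtopology X Y) (B n) n"
    have B: "B (Suc n) = attach_cells (subtopology (A n) (topspace (B n))) n ?Q'"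
      using Suc by (simp add: B_def)
    have A: "A (Suc n) = attach_cells (A n) n ?Q" by (simp add: A_def)
    have "?Q' = squares (subtopology X Y) (subtopology (A n) (topspace (B n))) n"
      using Suc by simp
    then have "?Q' \<subseteq> ?Q" by (auto simp: squares_subtopology)
    then show ?case
      unfolding A B
      using attach_cells_closed_subspace[of "A n" n "topspace (B n)" ?Q ?Q']
        Suc cw_dim_le squares_boundary unfolding A_def by metis
  qed
  then show "B n = subtopology (A n) (topspace (B n))" "closedin (A n) (topspace (B n))" by blast+
qed

text \<open>Being a square of Y is a condition on values alone; the inclusion of cells and the
  intersection formula both rest on this.\<close>

lemma squares_cw_stage_subtopology:
  "squares (subtopology X Y) (cw_stage (subtopology X Y) n) n =
    {(\<alpha>, \<beta>) \<in> squares X (cw_stage X n) n.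
      \<alpha> \<in> topspace (nsphere n) \<rightarrow> topspace (cw_stage (subtopology X Y) n) \<and>
      \<beta> \<in> topspace (ndisc (Suc n)) \<rightarrow> Y}"
  unfolding squares_subtopology[symmetric] cw_stage_subtopology(1)[symmetric] ..

lemma topspace_CW_subtopology: "topspace (CW (subtopology X Y)) \<subseteq> topspace (CW X)"
  unfolding topspace_CW using subset_refl closedin_subset[OF cw_stage_subtopology(2)] by (rule UN_mono)

text \<open>Closedness in the colimit is tested stage by stage, and \<open>int\<close> reduces each
  test to \<open>cw_stage_subtopology\<close>.\<close>

lemma CW_subtopology:
  "CW (subtopology X Y) = subtopology (CW X) (topspace (CW (subtopology X Y)))"
  "closedin (CW X) (topspace (CW (subtopology X Y)))"
proof -
  let ?A = "cw_stage X" and ?B = "cw_stage (subtopology X Y)" and ?Y = "CW (subtopology X Y)"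
  \<comment> \<open>A point of CW(Y) in stage n of X could a priori enter CW(Y) at a later stage;
    its dimension is at most n, which rules this out.\<close>
  have int: "topspace ?Y \<inter> topspace (?A n) = topspace (?B n)" for n
    using topspace_CW_subtopology[of X Y] by (auto simp: topspace_cw_stage)
  have "closedin (CW X) C" if "closedin ?Y C" for C
    unfolding closedin_CW
  proof (intro conjI allI)
    from that have C: "C \<subseteq> topspace ?Y" "\<And>n. closedin (?B n) (C \<inter> topspace (?B n))"
      unfolding closedin_CW by blast+
    show "C \<subseteq> topspace (CW X)" using C(1) topspace_CW_subtopology by blast
    fix n
    have "C \<inter> topspace (?A n) = C \<inter> topspace (?B n)" using C(1) int by blast
    then show "closedin (?A n) (C \<inter> topspace (?A n))"
      using C(2)[of n] cw_stage_subtopology[where X = X and Y = Y and n = n] closedin_trans_full by metis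
  qed
  moreover have "closedin ?Y (C \<inter> topspace ?Y)" if "closedin (CW X) C" for C
    unfolding closedin_CW
  proof (intro conjI allI)
    fix n
    have "C \<inter> topspace ?Y \<inter> topspace (?B n) = (C \<inter> topspace (?A n)) \<inter> topspace (?B n)"
      using int[of n] by blast
    moreover have "closedin (?A n) (C \<inter> topspace (?A n))"
      using that unfolding closedin_CW by blast
    ultimately show "closedin (?B n) (C \<inter> topspace ?Y \<inter> topspace (?B n))"
      using cw_stage_subtopology(1)[where X = X and Y = Y and n = n] closedin_subtopology by metis
  qed blast
  ultimately show "?Y = subtopology (CW X) (topspace ?Y)"
    by (rule closed_subspace_eqI)
  show "closedin (CW X) (topspace ?Y)"
    using \<open>\<And>C. closedin ?Y C \<Longrightarrow> closedin (CW X) C\<close> closedin_topspace .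
qed

section \<open>The induced map and subcomplexes\<close>

text \<open>Restricting an extensional map to its own domain changes nothing. \<open>CW_incl\<close>
  recurs on the values of \<alpha>, which lie in the preceding stage, hence the induction over
  stages.\<close>

lemma CW_incl_id:
  assumes "p \<in> topspace (CW X)"
  shows "CW_incl p = p"
proof -
  have "p \<in> topspace (cw_stage X n) \<Longrightarrow> CW_incl p = p" for n
  proof (induction n arbitrary: p)
    case 0
    then show ?case by (auto simp: cmaps_def fun_eq_iff extensional_def)
  next
    case (Suc n)
    show ?case
    proof (cases "p \<in> topspace (cw_stage X n)")
      case True then show ?thesis by (rule Suc.IH)
    next
      case False
      then obtain \<alpha> \<beta> x where q: "(\<alpha>, \<beta>) \<in> squares X (cw_stage X n) n" and p: "p = Cell (Suc n) \<alpha> \<beta> x"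
        using Suc.prems unfolding topspace_cw_stage_Suc by blast
      have ext: "\<alpha> \<in> extensional (topspace (nsphere n))" "\<beta> \<in> extensional (topspace (ndisc (Suc n)))"
        using q by (auto simp: squares_def cmaps_def)
      have "CW_incl (\<alpha> y) = \<alpha> y" if "y \<in> topspace (nsphere n)" for y
        using squares_boundary(2)[OF q] that by (intro Suc.IH) blast
      \<comment> \<open>For a cell of dimension \<open>Suc n\<close>, the sphere
        \<open>nsphere (Suc n - 1)\<close> in \<open>CW_map\<close> is \<open>nsphere n\<close>, the
        domain of \<alpha>.\<close>
      then have "restrict (CW_incl \<circ> \<alpha>) (topspace (nsphere n)) = \<alpha>"
        using ext(1) by (auto simp: fun_eq_iff extensional_def)
      moreover have "restrict ((\<lambda>x. x) \<circ> \<beta>) (topspace (ndisc (Suc n))) = \<beta>"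
        using ext(2) by (auto simp: fun_eq_iff extensional_def)
      ultimately show ?thesis by (simp add: p)
    qed
  qed
  then show ?thesis using assms by (auto simp: topspace_CW)
qed

text \<open>Here \<open>CW_incl_id\<close> is applied with the subspace in the role of X;
  subcomplexes become plain sets of points.\<close>

lemma CW_sub_eq: "CW_sub X Y = topspace (CW (subtopology X Y))"
  unfolding CW_sub_def by (simp add: CW_incl_id cong: image_cong_simp)

lemma Union_CW_cells: "topspace (CW X) = \<Union>(\<Union>n. CW_cells X n)"
proof -
  have "topspace (cw_stage X n) = \<Union>(\<Union>m\<le>n. CW_cells X m)" for n
  proof (induction n)
    case 0
    then show ?case by (auto simp: CW_cells_def)
  next
    case (Suc n)
    then show ?case
      unfolding topspace_cw_stage_Suc atMost_Suc by (auto simp: CW_cells_def)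
  qed
  then show ?thesis by (auto simp: topspace_CW)
qed

lemma CW_cells_subtopology: "CW_cells (subtopology X Y) n \<subseteq> CW_cells X n"
proof (cases n)
  case 0
  then show ?thesis
    using closedin_subset[OF cw_stage_subtopology(2)[of X 0 Y]] by (auto simp: CW_cells_def)
next
  case (Suc m)
  then show ?thesis
    by (auto simp: CW_cells_def squares_cw_stage_subtopology simp del: cw_stage.simps)
qed

lemma subcomplex_inclusion_CW:
  "subcomplex_inclusion (CW (subtopology X Y)) (CW_cells (subtopology X Y)) (CW X) (CW_cells X) CW_incl"
  unfolding subcomplex_inclusion_def subcomplex_def
proof (intro conjI allI ballI)
  let ?Y = "CW (subtopology X Y)"
  have im: "CW_incl ` topspace ?Y = topspace ?Y"
    using CW_sub_eq[of X Y] by (simp add: CW_sub_def)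
  \<comment> \<open>\<open>?Y\<close> is literally a subspace of \<open>CW X\<close>, so
    \<open>id\<close> embeds it, and \<open>CW_incl\<close> agrees with \<open>id\<close> on its
    points.\<close>
  have "embedding_map ?Y (CW X) id"
    unfolding embedding_map_def using CW_subtopology(1)[of X Y] by simp
  then show "embedding_map ?Y (CW X) CW_incl"
    by (rule embedding_map_eq) (simp add: CW_incl_id)
  show "closedin (CW X) (CW_incl ` topspace ?Y)"
    unfolding im by (rule CW_subtopology(2))
  \<comment> \<open>The witness consists of all open cells of CW(Y), which are open cells of
    CW(X).\<close>
  show "\<exists>E\<subseteq>\<Union>n. CW_cells X n. CW_incl ` topspace ?Y = \<Union>E"
    unfolding im using Union_CW_cells[of "subtopology X Y"] CW_cells_subtopology[of X Y]
    by (intro exI[of _ "\<Union>n. CW_cells (subtopology X Y) n"]) blast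
  fix n e assume e: "e \<in> CW_cells (subtopology X Y) n"
  then have "e \<subseteq> topspace ?Y" unfolding Union_CW_cells by blast
  then have "CW_incl ` e = e" using CW_incl_id by force
  then show "CW_incl ` e \<in> CW_cells X n" using e CW_cells_subtopology by (metis subsetD)
qed

section \<open>Intersections\<close>

text \<open>A cell point remembers its square, so points of top dimension intersect as squares do,
  and lower points are covered by induction. The factor \<open>topspace X\<close> makes the
  intersection of the empty family the whole space.\<close>

lemma topspace_cw_stage_INT:
  "topspace (cw_stage (subtopology X (topspace X \<inter> (\<Inter>s\<in>S. Xs s))) n) =
    topspace (cw_stage X n) \<inter> (\<Inter>s\<in>S. topspace (cw_stage (subtopology X (Xs s)) n))"
proof (induction n)
  case 0
  show ?case by (auto simp: cmaps_subtopology Pi_iff image_iff dest: cmaps_funcset)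
next
  case (Suc n)
  let ?Z = "subtopology X (topspace X \<inter> (\<Inter>s\<in>S. Xs s))" and ?A = "cw_stage X"
  let ?B = "\<lambda>s. cw_stage (subtopology X (Xs s))"
  \<comment> \<open>This absorbs the factor \<open>topspace X\<close> in the condition on
    \<beta>.\<close>
  have "\<beta> \<in> topspace (ndisc (Suc n)) \<rightarrow> topspace X" if "(\<alpha>, \<beta>) \<in> squares X (?A n) n" for \<alpha> \<beta>
    using that cmaps_funcset by (auto simp: squares_def)
  \<comment> \<open>The condition on \<alpha> concerns the preceding stage of \<open>?Z\<close>,
    which the induction hypothesis writes as an intersection.\<close>
  then have sq: "squares ?Z (cw_stage ?Z n) n =
      squares X (?A n) n \<inter> (\<Inter>s\<in>S. squares (subtopology X (Xs s)) (?B s n) n)"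
    unfolding squares_cw_stage_subtopology Suc
    using squares_boundary(2)[of _ _ X "?A n" n] by (auto simp: Pi_iff image_subset_iff)
  have new: "Cell (Suc n) \<alpha> \<beta> x \<notin> topspace (cw_stage W n)" for \<alpha> \<beta> x and W :: "'a topology"
    using cw_dim_le[of "Cell (Suc n) \<alpha> \<beta> x" W n] by auto
  have old: "p \<in> topspace (cw_stage W (Suc n)) \<longleftrightarrow> p \<in> topspace (cw_stage W n)"
    if "cw_dim p \<le> n" for p and W :: "'a topology"
    using that by (auto simp: topspace_cw_stage simp del: cw_stage.simps)
  have cell: "Cell (Suc n) \<alpha> \<beta> x \<in> topspace (cw_stage W (Suc n)) \<longleftrightarrow>
      (\<alpha>, \<beta>) \<in> squares W (cw_stage W n) n \<and> x \<in> ndisc_interior (Suc n)" for \<alpha> \<beta> x and W :: "'a topology"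
    unfolding topspace_cw_stage_Suc using new by auto
  have "p \<in> topspace (cw_stage ?Z (Suc n)) \<longleftrightarrow>
      p \<in> topspace (?A (Suc n)) \<inter> (\<Inter>s\<in>S. topspace (?B s (Suc n)))" for p
  proof (cases "cw_dim p \<le> n")
    case True
    then show ?thesis using old[OF True] Suc by (simp del: cw_stage.simps)
  next
    case False
    show ?thesis
    proof (cases p)
      case (Vertex \<beta>)
      with False show ?thesis by simp
    next
      case (Cell k \<alpha> \<beta> x)
      show ?thesis
      proof (cases "k = Suc n")
        case True
        then show ?thesis using sq Cell by (auto simp: cell simp del: cw_stage.simps)
      next
        case False
        \<comment> \<open>The dimension of \<open>p\<close> now exceeds \<open>Suc n\<close>, so
          \<open>p\<close> lies on neither side.\<close>
        with \<open>\<not> cw_dim p \<le> n\<close> Cell have "\<not> cw_dim p \<le> Suc n" by simp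
        then show ?thesis using cw_dim_le by blast
      qed
    qed
  qed
  then show ?case by blast
qed

lemma topspace_CW_INT:
  "topspace (CW (subtopology X (topspace X \<inter> (\<Inter>s\<in>S. Xs s)))) =
    topspace (CW X) \<inter> (\<Inter>s\<in>S. topspace (CW (subtopology X (Xs s))))" (is "?L = ?R")
proof -
  \<comment> \<open>The single stage \<open>cw_dim p\<close> decides membership in all the complexes
    at once, so no common stage for the different s has to be found.\<close>
  have "p \<in> ?L \<longleftrightarrow> p \<in> ?R" for p
    using topspace_cw_stage_INT[of X Xs S "cw_dim p"] by (auto simp: topspace_cw_stage)
  then show ?thesis by blast
qed

theorem theorem2p5:
  fixes X :: "'a topology" and S :: "'s set" and Xs :: "'s \<Rightarrow> 'a set"
  assumes "\<And>s. s \<in> S \<Longrightarrow> Xs s \<subseteq> topspace X"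
  shows "(\<forall>s\<in>S. subcomplex_inclusion
             (CW (subtopology X (Xs s))) (CW_cells (subtopology X (Xs s)))
             (CW X) (CW_cells X) CW_incl) \<and>
         topspace (CW X) \<inter> (\<Inter>s\<in>S. CW_sub X (Xs s)) =
           CW_sub X (topspace X \<inter> (\<Inter>s\<in>S. Xs s))"
  \<comment> \<open>Rewriting with \<open>topspace_CW_INT\<close> turns the right side of the
    equation into the left one.\<close>
  unfolding CW_sub_eq topspace_CW_INT by (intro conjI ballI refl subcomplex_inclusion_CW)

end
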